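(* Let $n>1$ be an integer. If the sequence $$state_0\to state_1\to\dots\to state_k$$ is a solution of the jealous husbands problem (HW), then the sequence $$g(S_n state_0)\to g(S_n state_1)\to\dots\to g(S_n state_k)$$ is a solution of the missionaries and cannibals problem (MC), where $S_n state$ denotes the $S_n$-orbit of $state$ and $g:V/\!\sim\ \to V'$ is the map sending the orbit of $(L,R,loc)$ to $\bigl((|L|_W,|L|_H),(|R|_W,|R|_H),loc\bigr)$.
   Context: Boat capacity: in both problems the boat carries at most $b$ people, where $b=2$ if $n\le 3$, $b=3$ if $n\in\{4,5\}$, $b=4$ if $n\ge 6$. HW problem. Let $W=\{w_1,\dots,w_n\}$ be the set of wives, $H=\{h_1,\dots,h_n\}$ the set of husbands ($h_i$ is the husband of $w_i$), and $U=W\cup H$ ($2n$ distinct people). A subset $X\subseteq U$ is safe if either $X\cap H=\emptyset$, or for every $w_i\in X$ also $h_i\in X$. A state is a triple $(L,R,loc)$ with $L\subseteq U$, $R=U\setminus L$ (people on the left, resp. right bank), $loc\in\{left,right\}$ (the boat's location); it is admissible if both $L$ and $R$ are safe. Only admissible states are considered; $V$ is the set of all of them. A transition $(L_1,R_1,loc_1)\xrightarrow{f}(L_2,R_2,loc_2)$ between admissible states, with move $f=(B,loc_1)$, means: $loc_2\ne loc_1$, $B$ is a safe set of people with $0<|B|\le b$, and if $loc_1=left$ then $B\subseteq L_1$, $L_2=L_1\setminus B$, $R_2=R_1\cup B$, while if $loc_1=right$ then $B\subseteq R_1$, $R_2=R_1\setminus B$, $L_2=L_1\cup B$. A solution of HW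 is a finite sequence of states, consecutive ones joined by transitions, from $(U,\emptyset,left)$ to $(\emptyset,U,right)$. MC problem. A pair $(c,m)$ ($c$ cannibals, $m$ missionaries) of nonnegative integers is safe if $m=0$ or $c\le m$. A state is a triple $((c,m),(n-c,n-m),loc)$ with $0\le c,m\le n$, $loc\in\{left,right\}$ (left bank, right bank, boat's location); it is admissible if both pairs are safe. $V'$ is the set of admissible states. A transition $(L_1',R_1',loc_1)\to(L_2',R_2',loc_2)$ between admissible states, with move $(B',loc_1)$, means: $loc_2\neq loc_1$, $B'=(c,m)$ is a safe pair with $0<c+m\le b$, and $L_2'=L_1'-B'$, $R_2'=R_1'+B'$ (componentwise) if $loc_1=left$, while $R_2'=R_1'-B'$, $L_2'=L_1'+B'$ if $loc_1=right$. A solution of MC is a finite sequence of states, consecutive ones joined by transitions, from $((n,n),(0,0),left)$ to $((0,0),(n,n),right)$. Group action. For $X\subseteq U$ and $\pi\in S_n$ put $\pi X=\{w_{\pi(i)}\mid w_i\in X\}\cup\{h_{\pi(j)}\mid h_j\in X\}$, and $\pi(L,R,loc)=(\pi L,\pi R,loc)$; this is an action of $S_n$ on $V$, and $V/\!\sim$ is the set of its orbits. $|X|_W$ and $|X|_H$ denote the numbers of wives and of husbands in $X\subseteq U$. The map $g$ is well defined. *)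

theory Defs
  imports "HOL-Algebra.Sym_Groups" "HOL-Algebra.Group_Action"
begin

definition boat_capacity :: "nat \<Rightarrow> nat" where
  "boat_capacity n = (if n \<le> 3 then 2 else if n \<le> 5 then 3 else 4)"

datatype side = LeftBank | RightBank

datatype person = Wife nat | Husband nat

type_synonym hw_state = "person set \<times> person set \<times> side"

definition wives :: "nat \<Rightarrow> person set" where
  "wives n = Wife ` {1..n}"

definition husbands :: "nat \<Rightarrow> person set" where
  "husbands n = Husband ` {1..n}"

definition people :: "nat \<Rightarrow> person set" where
  "people n = wives n \<union> husbands n"

definition hw_safe :: "nat \<Rightarrow> person set \<Rightarrow> bool" where
  "hw_safe n X \<longleftrightarrow> X \<subseteq> people n \<and>
     (X \<inter> husbands n = {} \<or> (\<forall>i\<in>{1..n}. Wife i \<in> X \<longrightarrow> Husband i \<in> X))"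

definition hw_states :: "nat \<Rightarrow> hw_state set" where
  "hw_states n = {(L, R, loc). L \<subseteq> people n \<and> R = people n - L \<and> hw_safe n L \<and> hw_safe n R}"

fun hw_move :: "nat \<Rightarrow> hw_state \<Rightarrow> person set \<times> side \<Rightarrow> hw_state \<Rightarrow> bool" where
  "hw_move n (L1, R1, loc1) (B, loc) (L2, R2, loc2) \<longleftrightarrow>
     (L1, R1, loc1) \<in> hw_states n \<and> (L2, R2, loc2) \<in> hw_states n \<and>
     loc = loc1 \<and> loc2 \<noteq> loc1 \<and>
     hw_safe n B \<and> 0 < card B \<and> card B \<le> boat_capacity n \<and>
     (case loc1 of
        LeftBank \<Rightarrow> B \<subseteq> L1 \<and> L2 = L1 - B \<and> R2 = R1 \<union> B
      | RightBank \<Rightarrow> B \<subseteq> R1 \<and> R2 = R1 - B \<and> L2 = L1 \<union> B)"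

definition hw_transition :: "nat \<Rightarrow> hw_state \<Rightarrow> hw_state \<Rightarrow> bool" where
  "hw_transition n s t \<longleftrightarrow> (\<exists>f. hw_move n s f t)"

definition hw_solution :: "nat \<Rightarrow> hw_state list \<Rightarrow> bool" where
  "hw_solution n ss \<longleftrightarrow> ss \<noteq> [] \<and> set ss \<subseteq> hw_states n \<and>
     hd ss = (people n, {}, LeftBank) \<and> last ss = ({}, people n, RightBank) \<and>
     successively (hw_transition n) ss"

text \<open>In every pair the first component counts cannibals, the second missionaries.\<close>

type_synonym mc_state = "(nat \<times> nat) \<times> (nat \<times> nat) \<times> side"

fun mc_safe :: "nat \<times> nat \<Rightarrow> bool" where
  "mc_safe (c, m) \<longleftrightarrow> m = 0 \<or> c \<le> m"

definition mc_states :: "nat \<Rightarrow> mc_state set" where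
  "mc_states n = {((c, m), (n - c, n - m), loc) | c m loc.
     c \<le> n \<and> m \<le> n \<and> mc_safe (c, m) \<and> mc_safe (n - c, n - m)}"

text \<open>The bounds on \<open>c\<close> and \<open>m\<close> in the case distinction make the subtractions on
  \<^typ>\<open>nat\<close> agree with those on the integers.\<close>

fun mc_move :: "nat \<Rightarrow> mc_state \<Rightarrow> (nat \<times> nat) \<times> side \<Rightarrow> mc_state \<Rightarrow> bool" where
  "mc_move n ((cl1, ml1), (cr1, mr1), loc1) ((c, m), loc) ((cl2, ml2), (cr2, mr2), loc2) \<longleftrightarrow>
     ((cl1, ml1), (cr1, mr1), loc1) \<in> mc_states n \<and>
     ((cl2, ml2), (cr2, mr2), loc2) \<in> mc_states n \<and>
     loc = loc1 \<and> loc2 \<noteq> loc1 \<and>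
     mc_safe (c, m) \<and> 0 < c + m \<and> c + m \<le> boat_capacity n \<and>
     (case loc1 of
        LeftBank \<Rightarrow> c \<le> cl1 \<and> m \<le> ml1 \<and>
          (cl2, ml2) = (cl1 - c, ml1 - m) \<and> (cr2, mr2) = (cr1 + c, mr1 + m)
      | RightBank \<Rightarrow> c \<le> cr1 \<and> m \<le> mr1 \<and>
          (cr2, mr2) = (cr1 - c, mr1 - m) \<and> (cl2, ml2) = (cl1 + c, ml1 + m))"

definition mc_transition :: "nat \<Rightarrow> mc_state \<Rightarrow> mc_state \<Rightarrow> bool" where
  "mc_transition n s t \<longleftrightarrow> (\<exists>f. mc_move n s f t)"

definition mc_solution :: "nat \<Rightarrow> mc_state list \<Rightarrow> bool" where
  "mc_solution n ss \<longleftrightarrow> ss \<noteq> [] \<and> set ss \<subseteq> mc_states n \<and>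
     hd ss = ((n, n), (0, 0), LeftBank) \<and> last ss = ((0, 0), (n, n), RightBank) \<and>
     successively (mc_transition n) ss"

definition act_set :: "(nat \<Rightarrow> nat) \<Rightarrow> person set \<Rightarrow> person set" where
  "act_set \<pi> X = {Wife (\<pi> i) | i. Wife i \<in> X} \<union> {Husband (\<pi> j) | j. Husband j \<in> X}"

text \<open>The restriction to admissible states is required by \<^locale>\<open>group_action\<close>, whose
  permutations are extensional functions.\<close>

definition hw_act :: "nat \<Rightarrow> (nat \<Rightarrow> nat) \<Rightarrow> hw_state \<Rightarrow> hw_state" where
  "hw_act n \<pi> = (\<lambda>(L, R, loc)\<in>hw_states n. (act_set \<pi> L, act_set \<pi> R, loc))"

definition hw_orbit :: "nat \<Rightarrow> hw_state \<Rightarrow> hw_state set" where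
  "hw_orbit n s = Group_Action.orbit (sym_group n) (hw_act n) s"

definition count_pair :: "nat \<Rightarrow> person set \<Rightarrow> nat \<times> nat" where
  "count_pair n X = (card (X \<inter> wives n), card (X \<inter> husbands n))"

text \<open>The counts are constant on an orbit, so the image below is a singleton; its element is
  the value of the quotient map at the orbit.\<close>

definition g_map :: "nat \<Rightarrow> hw_state set \<Rightarrow> mc_state" where
  "g_map n Orb = the_elem ((\<lambda>(L, R, loc). (count_pair n L, count_pair n R, loc)) ` Orb)"

end

theory Submission
  imports Defs
begin

text \<open>Counting wives and husbands forgets only the labels, so it is constant on orbits and
  additive under moves. In a safe set containing a husband, the map taking each wife to her husband
  is injective, so there are at most as many wives as husbands.\<close>

text \<open>This is the quotient map read on representatives, so that later arguments can work with
  single states instead of orbits.\<close>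

definition counts :: "nat \<Rightarrow> hw_state \<Rightarrow> mc_state" where
  "counts n = (\<lambda>(L, R, loc). (count_pair n L, count_pair n R, loc))"

lemma finite_wives [simp]: "finite (wives n)"
  and finite_husbands [simp]: "finite (husbands n)"
  by (simp_all add: wives_def husbands_def)

lemma wives_husbands_disjoint: "wives n \<inter> husbands n = {}"
  by (auto simp: wives_def husbands_def)

lemma card_wives [simp]: "card (wives n) = n"
  and card_husbands [simp]: "card (husbands n) = n"
  by (simp_all add: wives_def husbands_def card_image inj_on_def)

lemma count_pair_empty [simp]: "count_pair n {} = (0, 0)"
  by (simp add: count_pair_def)

lemma count_pair_people [simp]: "count_pair n (people n) = (n, n)"
  by (simp add: count_pair_def people_def Int_absorb1)

text \<open>Needed to turn the bounds on the number of people in the boat into bounds on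
  \<open>c + m\<close>.\<close>

lemma card_eq_wives_plus_husbands:
  assumes "X \<subseteq> people n"
  shows "card X = card (X \<inter> wives n) + card (X \<inter> husbands n)"
proof -
  have "X = (X \<inter> wives n) \<union> (X \<inter> husbands n)"
    using assms by (auto simp: people_def)
  moreover have "(X \<inter> wives n) \<inter> (X \<inter> husbands n) = {}"
    using wives_husbands_disjoint by blast
  ultimately show ?thesis
    by (metis card_Un_disjoint finite_Int finite_husbands finite_wives)
qed

lemma card_Diff_Int:
  assumes "finite C" "B \<subseteq> A"
  shows "card ((A - B) \<inter> C) = card (A \<inter> C) - card (B \<inter> C)"
proof -
  have "(A - B) \<inter> C = (A \<inter> C) - (B \<inter> C)" by blast
  moreover have "finite (B \<inter> C)" "B \<inter> C \<subseteq> A \<inter> C" using assms by auto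
  ultimately show ?thesis by (simp only: card_Diff_subset)
qed

lemma card_Un_Int:
  assumes "finite C" "A \<inter> B = {}"
  shows "card ((A \<union> B) \<inter> C) = card (A \<inter> C) + card (B \<inter> C)"
proof -
  have "(A \<inter> C) \<inter> (B \<inter> C) = {}" using assms(2) by blast
  then show ?thesis using assms(1) by (simp add: Int_Un_distrib2 card_Un_disjoint)
qed

lemma card_Int_mono:
  assumes "finite C" "B \<subseteq> A"
  shows "card (B \<inter> C) \<le> card (A \<inter> C)"
  using assms by (intro card_mono) auto

text \<open>A permutation of \<open>{1..n}\<close> sends a label into this range exactly when the
  label lies there, so restricting to wives commutes with relabelling. The form as an iterated image
  prepares for \<open>card_image\<close>.\<close>

lemma act_set_Int_wives:
  assumes "\<pi> permutes {1..n}"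
  shows "act_set \<pi> X \<inter> wives n = Wife ` \<pi> ` {i \<in> {1..n}. Wife i \<in> X}"
  using permutes_in_image[OF assms] by (auto simp: act_set_def wives_def)

lemma act_set_Int_husbands:
  assumes "\<pi> permutes {1..n}"
  shows "act_set \<pi> X \<inter> husbands n = Husband ` \<pi> ` {i \<in> {1..n}. Husband i \<in> X}"
  using permutes_in_image[OF assms] by (auto simp: act_set_def husbands_def)

lemma Int_wives_eq: "X \<inter> wives n = Wife ` {i \<in> {1..n}. Wife i \<in> X}"
  and Int_husbands_eq: "X \<inter> husbands n = Husband ` {i \<in> {1..n}. Husband i \<in> X}"
  by (auto simp: wives_def husbands_def)

lemma inj_Wife: "inj_on Wife A"
  and inj_Husband: "inj_on Husband A"
  by (simp_all add: inj_on_def)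

lemma count_pair_act_set:
  assumes "\<pi> permutes {1..n}"
  shows "count_pair n (act_set \<pi> X) = count_pair n X"
proof -
  have "inj_on \<pi> A" for A
    using permutes_inj[OF assms] by (rule inj_on_subset) simp
  then show ?thesis
    unfolding count_pair_def act_set_Int_wives[OF assms] act_set_Int_husbands[OF assms]
      Int_wives_eq[of X] Int_husbands_eq[of X]
    by (simp add: card_image inj_Wife inj_Husband)
qed

lemma counts_hw_act:
  assumes "s \<in> hw_states n" "\<pi> permutes {1..n}"
  shows "counts n (hw_act n \<pi> s) = counts n s"
  using assms by (cases s) (simp add: hw_act_def counts_def count_pair_act_set)

text \<open>By invariance under the action, \<open>counts n\<close> takes one value on the orbit,
  and \<open>the_elem\<close> extracts it.\<close>

lemma g_map_hw_orbit:
  assumes "s \<in> hw_states n"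
  shows "g_map n (hw_orbit n s) = counts n s"
proof -
  have "hw_orbit n s = (\<lambda>\<pi>. hw_act n \<pi> s) ` {\<pi>. \<pi> permutes {1..n}}"
    by (auto simp: hw_orbit_def Group_Action.orbit_def sym_group_def)
  \<comment> \<open>Without a group element the image of the orbit would be empty rather than a
    singleton.\<close>
  moreover have "{\<pi>. \<pi> permutes {1..n}} \<noteq> {}"
    using permutes_id by blast
  ultimately have "counts n ` hw_orbit n s = {counts n s}"
    using counts_hw_act[OF assms] by (auto simp: image_image)
  then show ?thesis
    by (simp add: g_map_def counts_def)
qed

lemma mc_safe_count_pair:
  assumes "hw_safe n X"
  shows "mc_safe (count_pair n X)"
proof (cases "X \<inter> husbands n = {}")
  case True
  then show ?thesis by (simp add: count_pair_def)
next
  case False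
  \<comment> \<open>On labels, the injection from wives to their husbands becomes an
    inclusion.\<close>
  then have "{i \<in> {1..n}. Wife i \<in> X} \<subseteq> {i \<in> {1..n}. Husband i \<in> X}"
    using assms by (auto simp: hw_safe_def)
  then have "card {i \<in> {1..n}. Wife i \<in> X} \<le> card {i \<in> {1..n}. Husband i \<in> X}"
    by (intro card_mono) auto
  then show ?thesis
    by (simp add: count_pair_def Int_wives_eq Int_husbands_eq card_image inj_Wife inj_Husband)
qed

lemma counts_in_mc_states:
  assumes "s \<in> hw_states n"
  shows "counts n s \<in> mc_states n"
proof -
  obtain L loc where s: "s = (L, people n - L, loc)"
    and L: "L \<subseteq> people n" "hw_safe n L" "hw_safe n (people n - L)"
    using assms by (auto simp: hw_states_def)
  define c m where "c = card (L \<inter> wives n)" and "m = card (L \<inter> husbands n)"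
  \<comment> \<open>The right bank is the complement of the left one, so its counts are differences
    from the totals, which are both \<open>n\<close>.\<close>
  have "people n \<inter> wives n = wives n" "people n \<inter> husbands n = husbands n"
    by (auto simp: people_def)
  then have R: "count_pair n (people n - L) = (n - c, n - m)"
    using L(1) by (simp add: count_pair_def card_Diff_Int c_def m_def)
  have le: "c \<le> n" "m \<le> n"
    using card_mono[of "wives n" "L \<inter> wives n"] card_mono[of "husbands n" "L \<inter> husbands n"]
    by (simp_all add: c_def m_def)
  have "count_pair n L = (c, m)"
    by (simp add: count_pair_def c_def m_def)
  with R have "counts n s = ((c, m), (n - c, n - m), loc)"
    by (simp add: counts_def s)
  moreover have "mc_safe (c, m)" "mc_safe (n - c, n - m)"
    using mc_safe_count_pair[OF L(2)] mc_safe_count_pair[OF L(3)] R \<open>count_pair n L = (c, m)\<close>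
    by simp_all
  ultimately show ?thesis
    using le unfolding mc_states_def by blast
qed

lemma counts_transition:
  assumes "hw_transition n s t"
  shows "mc_transition n (counts n s) (counts n t)"
proof -
  obtain L1 R1 loc1 where s: "s = (L1, R1, loc1)" by (cases s)
  obtain L2 R2 loc2 where t: "t = (L2, R2, loc2)" by (cases t)
  obtain B where st: "s \<in> hw_states n" "t \<in> hw_states n" and loc: "loc2 \<noteq> loc1"
    and B: "hw_safe n B" "0 < card B" "card B \<le> boat_capacity n"
    and step: "case loc1 of
        LeftBank \<Rightarrow> B \<subseteq> L1 \<and> L2 = L1 - B \<and> R2 = R1 \<union> B
      | RightBank \<Rightarrow> B \<subseteq> R1 \<and> R2 = R1 - B \<and> L2 = L1 \<union> B"
    using assms by (auto simp: hw_transition_def s t)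
  \<comment> \<open>The boat's passengers come from one bank, so they are disjoint from the other;
    this makes counts add up on arrival.\<close>
  have disj: "L1 \<inter> R1 = {}"
    using st(1) by (auto simp: s hw_states_def)
  have card_B: "card B = card (B \<inter> wives n) + card (B \<inter> husbands n)"
    using B(1) by (intro card_eq_wives_plus_husbands) (simp add: hw_safe_def)
  note states = counts_in_mc_states[OF st(1)] counts_in_mc_states[OF st(2)]
  note safe = mc_safe_count_pair[OF B(1)]
  \<comment> \<open>The witness for the move is the pair of counts of the passengers
    \<open>B\<close>. Since \<open>B\<close> lies within the departure bank, its counts are at most
    those of that bank, as the subtractions on \<open>nat\<close> require.\<close>
  have "mc_move n (counts n s) (count_pair n B, loc1) (counts n t)"
  proof (cases loc1)
    case LeftBank
    with step have m: "B \<subseteq> L1" "L2 = L1 - B" "R2 = R1 \<union> B" by simp_all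
    with disj have "R1 \<inter> B = {}" by blast
    with m show ?thesis
      using states safe loc B(2,3) LeftBank
      unfolding s t counts_def count_pair_def prod.case mc_move.simps card_B
      by (simp add: card_Diff_Int card_Un_Int card_Int_mono)
  next
    case RightBank
    with step have m: "B \<subseteq> R1" "R2 = R1 - B" "L2 = L1 \<union> B" by simp_all
    with disj have "L1 \<inter> B = {}" by blast
    with m show ?thesis
      using states safe loc B(2,3) RightBank
      unfolding s t counts_def count_pair_def prod.case mc_move.simps card_B
      by (simp add: card_Diff_Int card_Un_Int card_Int_mono)
  qed
  then show ?thesis
    unfolding mc_transition_def by blast
qed

theorem mainTheorem2:
  fixes n :: nat and states :: "hw_state list"
  assumes "n > 1"
    and "hw_solution n states"
  shows "mc_solution n (map (\<lambda>state. g_map n (hw_orbit n state)) states)"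
proof -
  have sol: "states \<noteq> []" "set states \<subseteq> hw_states n"
    "hd states = (people n, {}, LeftBank)" "last states = ({}, people n, RightBank)"
    "successively (hw_transition n) states"
    using assms(2) by (simp_all add: hw_solution_def)
  \<comment> \<open>Every state in the list is admissible, so orbits can be replaced by
    representatives throughout.\<close>
  have eq: "map (\<lambda>state. g_map n (hw_orbit n state)) states = map (counts n) states"
    using sol(2) by (auto simp: g_map_hw_orbit)
  have "successively (mc_transition n) (map (counts n) states)"
    \<comment> \<open>This pulls the relation back along \<open>counts n\<close>, leaving an
      implication between two relations on the original list.\<close>
    unfolding successively_map
    using sol(5) by (rule successively_mono) (rule counts_transition)
  moreover have "counts n ` set states \<subseteq> mc_states n"
    using sol(2) counts_in_mc_states by blast
  ultimately show ?thesis
    unfolding eq using sol(1,3,4) by (simp add: mc_solution_def hd_map last_map counts_def)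
qed

end
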